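(* If $T$ is an arithmetic rank-one transformation, then $T$ is weak doubly ergodic.
   Context: A column is an ordered finite collection of pairwise disjoint intervals in $\mathbb R$ of equal length (its levels), thought of as stacked, with heights indexed from $0$; its column map $T_C$ sends each point of a level other than the top one to the point directly above it in the next level. A rank-one (cutting-and-stacking) transformation $T$ is given by columns $C_0,C_1,C_2,\dots$ as follows: $C_0$ is the single level consisting of the unit interval; $C_{n+1}$ is obtained from $C_n$ by cutting $C_n$ into $r_n\ge 2$ subcolumns of equal width, numbered $0,\dots,r_n-1$ from left to right, adding $s_{n,k}\ge 0$ new levels (spacers: intervals of the same length as the subcolumn levels, disjoint from $C_n$ and from each other) above the $k$-th subcolumn, and stacking each subcolumn (with its spacers) under the subcolumn to its right. $X$ is the union of all levels of all columns, $\mu$ is Lebesgue measure on $X$, and $T$ is the pointwise limit of the $T_{C_n}$; it is an invertible (mod null sets) measure-preserving transformation. It is assumed that $\mu(X)=\infty$. Let $h_n$ be the number of levels of $C_n$. The $n$-th height set is $$H_n=\{0\}\cup\Big\{\sum_{k=0}^{\ell}(h_n+s_{n,k}) : 0\le \ell<r_n-1\Big\},$$ so $|H_n|=r_n$. A rank-one transformation $T$ is an arithmetic rank-one transformation if there are an infinite sequence of (distinct) indices $n_i\to\infty$ ($i\in\mathbb N$), nonnegative integers $a_{n_i}$, integers $k_{n_i}\ge 1$, positive integers $s_{n_i}$ and a constant $\tau>0$ such that for every $i$ the height set $H_{n_i}$ contains the set $$S_{n_i}=\Big\{a_{n_i}+j\,h_{n_i}+\sum_{q=1}^{j}(k_{n_i}+q)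 : 0\le j\le s_{n_i}-1\Big\}$$ (that is, the set with elements $a_{n_i},\ a_{n_i}+h_{n_i}+k_{n_i}+1,\ a_{n_i}+2h_{n_i}+2k_{n_i}+3,\ \dots$), $\frac{s_{n_i}}{r_{n_i}}>\tau$ for all $i$, and the sequence $(r_{n_i})_i$ is unbounded (and $r_n\ge 2$ for all $n$). $T$ is weak doubly ergodic if for every pair of measurable sets $A,B$ of positive measure there is a positive integer $n$ with $\mu(A\cap T^{-n}A)>0$ and $\mu(B\cap T^{-n}A)>0$. *)

theory Defs
  imports "HOL-Analysis.Analysis"
begin

text \<open>
  Intervals are taken left-closed and right-open, so that cutting an interval into subintervals
  is an exact partition. A column is given by the common length of its levels and the list of
  their left endpoints, from bottom (height 0) to top.
\<close>

record column =
  lvl_length :: real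
  lefts :: "real list"

definition height :: "column \<Rightarrow> nat" where
  "height C = length (lefts C)"

definition level :: "column \<Rightarrow> nat \<Rightarrow> real set" where
  "level C j = {lefts C ! j ..< lefts C ! j + lvl_length C}"

definition column_union :: "column \<Rightarrow> real set" where
  "column_union C = (\<Union>j<height C. level C j)"

definition disjoint_levels :: "column \<Rightarrow> bool" where
  "disjoint_levels C \<longleftrightarrow> disjoint_family_on (level C) {..<height C}"

definition column_map :: "column \<Rightarrow> real \<Rightarrow> real option" where
  "column_map C x =
    (if \<exists>j. j + 1 < height C \<and> x \<in> level C j
     then (let j = (THE j. j + 1 < height C \<and> x \<in> level C j)
           in Some (lefts C ! (j + 1) + (x - lefts C ! j)))
     else None)"

definition unit_column :: column where
  "unit_column = \<lparr>lvl_length = 1, lefts = [0]\<rparr>"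

definition subcolumn :: "column \<Rightarrow> nat \<Rightarrow> nat \<Rightarrow> column" where
  "subcolumn C r k =
    \<lparr>lvl_length = lvl_length C / real r,
     lefts = map (\<lambda>a. a + real k * (lvl_length C / real r)) (lefts C)\<rparr>"

text \<open>
  The list \<open>sp k\<close> consists of the left endpoints of the spacers placed above the \<open>k\<close>-th subcolumn;
  their position in the real line is arbitrary apart from disjointness.
\<close>

definition cut_and_stack :: "nat \<Rightarrow> (nat \<Rightarrow> nat) \<Rightarrow> column \<Rightarrow> column \<Rightarrow> bool" where
  "cut_and_stack r s C C' \<longleftrightarrow>
    (\<exists>sp :: nat \<Rightarrow> real list.
      (let Sp = \<lparr>lvl_length = lvl_length C / real r, lefts = concat (map sp [0..<r])\<rparr>
       in (\<forall>k<r. length (sp k) = s k) \<and>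
          disjoint_levels Sp \<and>
          column_union Sp \<inter> column_union C = {} \<and>
          C' = \<lparr>lvl_length = lvl_length C / real r,
                lefts = concat (map (\<lambda>k. lefts (subcolumn C r k) @ sp k) [0..<r])\<rparr>))"

definition rank_one_space :: "(nat \<Rightarrow> column) \<Rightarrow> real set" where
  "rank_one_space C = (\<Union>n. column_union (C n))"

definition rank_one_measure :: "(nat \<Rightarrow> column) \<Rightarrow> real measure" where
  "rank_one_measure C = lebesgue_on (rank_one_space C)"

text \<open>
  With half-open levels, every point of the space lies below the top level of \<open>C n\<close> for all
  large \<open>n\<close>, and the column maps extend one another; so on the space the sequence below is
  eventually constant, and it is only outside the space that the value is meaningless.
\<close>

definition rank_one_map :: "(nat \<Rightarrow> column) \<Rightarrow> real \<Rightarrow> real" where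
  "rank_one_map C x = lim (\<lambda>n. the (column_map (C n) x))"

locale rank_one =
  fixes r :: "nat \<Rightarrow> nat" and s :: "nat \<Rightarrow> nat \<Rightarrow> nat" and C :: "nat \<Rightarrow> column"
  assumes cuts: "\<And>n. r n \<ge> 2"
    and base: "C 0 = unit_column"
    and step: "\<And>n. cut_and_stack (r n) (s n) (C n) (C (Suc n))"
    and infinite_measure: "emeasure (rank_one_measure C) (rank_one_space C) = \<infinity>"

definition height_set :: "(nat \<Rightarrow> nat) \<Rightarrow> (nat \<Rightarrow> nat \<Rightarrow> nat) \<Rightarrow> (nat \<Rightarrow> column) \<Rightarrow> nat \<Rightarrow> nat set" where
  "height_set r s C n = {0} \<union> {(\<Sum>k=0..l. (height (C n) + s n k)) | l. l < r n - 1}"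

definition staircase_set :: "nat \<Rightarrow> nat \<Rightarrow> nat \<Rightarrow> nat \<Rightarrow> nat set" where
  "staircase_set h a k m = {a + j * h + (\<Sum>q=1..j. (k + q)) | j. j \<le> m - 1}"

definition arithmetic_rank_one ::
    "(nat \<Rightarrow> nat) \<Rightarrow> (nat \<Rightarrow> nat \<Rightarrow> nat) \<Rightarrow> (nat \<Rightarrow> column) \<Rightarrow> bool" where
  "arithmetic_rank_one r s C \<longleftrightarrow> rank_one r s C \<and>
    (\<exists>(idx :: nat \<Rightarrow> nat) (a :: nat \<Rightarrow> nat) (k :: nat \<Rightarrow> nat) (m :: nat \<Rightarrow> nat) (\<tau> :: real).
      inj idx \<and> filterlim idx at_top sequentially \<and> \<tau> > 0 \<and>
      (\<forall>i. k (idx i) \<ge> 1 \<and> m (idx i) \<ge> 1 \<and>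
           staircase_set (height (C (idx i))) (a (idx i)) (k (idx i)) (m (idx i))
             \<subseteq> height_set r s C (idx i) \<and>
           real (m (idx i)) / real (r (idx i)) > \<tau>) \<and>
      \<not> bdd_above (range (\<lambda>i. r (idx i))))"

definition weak_doubly_ergodic :: "'a measure \<Rightarrow> ('a \<Rightarrow> 'a) \<Rightarrow> bool" where
  "weak_doubly_ergodic M T \<longleftrightarrow>
    (\<forall>A\<in>sets M. \<forall>B\<in>sets M. emeasure M A > 0 \<longrightarrow> emeasure M B > 0 \<longrightarrow>
      (\<exists>n>0. emeasure M (A \<inter> ((T ^^ n) -` A \<inter> space M)) > 0 \<and>
             emeasure M (B \<inter> ((T ^^ n) -` A \<inter> space M)) > 0))"

end

theory Submission
  imports Defs
begin

text \<open>
  Choose levels of one column that are almost filled by \<open>A\<close> and by \<open>B\<close>, at height difference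
  \<open>d\<close>. By averaging, every later column has levels \<open>I\<close>, \<open>J\<close> that are as full and have the same
  height difference, so we may pass to a column \<open>C n\<close> whose staircase is much longer than \<open>\<bar>d\<bar>\<close>.
  The consecutive gaps of the staircase increase by exactly one, hence the time that carries the
  \<open>t\<close>-th staircase copy of \<open>I\<close> to the next one also carries the \<open>(t + d)\<close>-th copy of \<open>J\<close> to the
  \<open>(t + d + 1)\<close>-th copy of \<open>I\<close>. Since the staircase contains a fixed proportion of all copies,
  for some \<open>t\<close> all copies involved are more than half full on average, and both overlaps have
  positive measure.
\<close>

section \<open>Addressing concatenated blocks by block number and position\<close>

lemma length_concat_map_upt:
  "length (concat (map f [0..<r])) = (\<Sum>k<r. length (f k))"
  by (induction r) auto

lemma nth_concat_map_upt:
  assumes "p < r" "j < length (f p)"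
  shows "concat (map f [0..<r]) ! ((\<Sum>k<p. length (f k)) + j) = f p ! j"
proof -
  have "[0..<r] = [0..<p] @ p # [Suc p..<r]"
    using assms(1) upt_add_eq_append[of 0 p "r - p"] by (simp add: upt_conv_Cons)
  then have "concat (map f [0..<r])
      = concat (map f [0..<p]) @ f p @ concat (map f [Suc p..<r])"
    by simp
  then show ?thesis
    using assms(2) by (simp add: nth_append length_concat_map_upt del: concat_map_singleton)
qed

lemma block_sum_less:
  fixes a :: "nat \<Rightarrow> nat"
  assumes "p < r" "j < a p"
  shows "(\<Sum>k<p. a k) + j < (\<Sum>k<r. a k)"
proof -
  have "(\<Sum>k<Suc p. a k) \<le> (\<Sum>k<r. a k)"
    using assms(1) by (intro sum_mono2) auto
  then show ?thesis using assms(2) by simp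
qed

text \<open>With \<open>block_sum_inject\<close> this gives coordinates. For
  \<open>a k = h n + s n k\<close>, a height in the next column becomes a copy \<open>p\<close> and
  a position \<open>j\<close> in that copy and its spacers.\<close>

lemma block_sum_exhaust:
  fixes a :: "nat \<Rightarrow> nat"
  assumes "l < (\<Sum>k<r. a k)"
  obtains p j where "p < r" "j < a p" "l = (\<Sum>k<p. a k) + j"
  using assms
proof (induction r arbitrary: thesis)
  case (Suc r)
  show ?case
  proof (cases "l < (\<Sum>k<r. a k)")
    case True
    then show ?thesis using Suc.IH Suc.prems(1) less_SucI by metis
  next
    case False
    then show ?thesis
      using Suc.prems(2) by (intro Suc.prems(1)[of r "l - (\<Sum>k<r. a k)"]) auto
  qed
qed simp

lemma block_sum_inject:
  fixes a :: "nat \<Rightarrow> nat"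
  assumes "j < a p" "j' < a p'" "(\<Sum>k<p. a k) + j = (\<Sum>k<p'. a k) + j'"
  shows "p = p' \<and> j = j'"
proof -
  have "\<not> p < p'" using block_sum_less[of p p' j a] assms by auto
  moreover have "\<not> p' < p" using block_sum_less[of p' p j' a] assms by auto
  ultimately show ?thesis using assms by (metis add_left_cancel linorder_neqE_nat)
qed

section \<open>Cutting a half-open interval into equal pieces\<close>

lemma half_open_interval_subdivide:
  fixes x a w :: real
  assumes "x \<in> {a..<a + w}" "r > 0"
  obtains p where "p < r" "x \<in> {a + real p * (w / real r)..<a + real p * (w / real r) + w / real r}"
proof -
  have w: "w > 0" using assms by auto
  define v where "v = w / real r"
  have v: "v > 0" "w = real r * v" using w assms by (auto simp: v_def)
  define p where "p = nat \<lfloor>(x - a) / v\<rfloor>"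
  have nn: "(x - a) / v \<ge> 0" using assms v by auto
  have p: "real p \<le> (x - a) / v" "(x - a) / v < real p + 1"
    using nn unfolding p_def by linarith+
  have "(x - a) / v < real r" using assms v by (auto simp: field_simps)
  then have "p < r" using p(1) by simp
  moreover have "x \<in> {a + real p * v..<a + real p * v + v}"
    using p v(1) by (auto simp: field_simps)
  ultimately show ?thesis using that unfolding v_def by blast
qed

lemma half_open_subinterval_disjoint:
  fixes x a v :: real
  assumes "x \<in> {a + real p * v..<a + real p * v + v}" "x \<in> {a + real q * v..<a + real q * v + v}"
  shows "p = q"
proof -
  have v: "v > 0" using assms(1) by auto
  have "real p * v < (real q + 1) * v" "real q * v < (real p + 1) * v"
    using assms by (auto simp: algebra_simps)
  then have "real p < real q + 1" "real q < real p + 1"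
    using v by (auto simp: mult_less_cancel_right)
  then show ?thesis by linarith
qed

section \<open>Counting deficits along a window of copies\<close>

lemma sum_shifted_inj_le:
  fixes f :: "nat \<Rightarrow> real" and c :: "nat \<Rightarrow> nat"
  assumes "\<And>p. p < r \<Longrightarrow> 0 \<le> f p" "inj_on c {..<m}" "c ` {..<m} \<subseteq> {..<r}" "y + L \<le> m"
  shows "(\<Sum>x<L. f (c (y + x))) \<le> (\<Sum>p<r. f p)"
proof -
  have "inj_on (\<lambda>x. c (y + x)) {..<L}"
  proof (rule inj_onI)
    fix x x' assume *: "x \<in> {..<L}" "x' \<in> {..<L}" "c (y + x) = c (y + x')"
    have "y + x \<in> {..<m}" "y + x' \<in> {..<m}" using *(1,2) assms(4) by auto
    from inj_onD[OF assms(2) *(3) this] show "x = x'" by simp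
  qed
  then have "(\<Sum>x<L. f (c (y + x))) = (\<Sum>p\<in>(\<lambda>x. c (y + x)) ` {..<L}. f p)"
    by (simp add: sum.reindex)
  also have "\<dots> \<le> (\<Sum>p<r. f p)"
    using assms by (intro sum_mono2) (auto simp: image_subset_iff)
  finally show ?thesis .
qed

text \<open>Here \<open>f p\<close> and \<open>g p\<close> stand for the fractions missing from copy
  \<open>p\<close> of two levels. If each \<open>x < L\<close> had a sum of at least 1, the total
  over the window would reach \<open>L\<close>. But \<open>c\<close> is injective, so each of the
  four shifted sums is at most the sum over all copies.\<close>

lemma small_deficits_exist:
  fixes f g :: "nat \<Rightarrow> real"
  assumes f: "\<And>p. p < r \<Longrightarrow> 0 \<le> f p" and g: "\<And>p. p < r \<Longrightarrow> 0 \<le> g p"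
    and c: "inj_on c {..<m}" "c ` {..<m} \<subseteq> {..<r}" and "u + v + L + 1 \<le> m"
    and small: "3 * (\<Sum>p<r. f p + g p) < real L"
  shows "\<exists>x<L. f (c (u + x)) + f (c (u + 1 + x)) < 1 \<and> g (c (v + x)) + f (c (v + 1 + x)) < 1"
proof (rule ccontr)
  assume neg: "\<not> ?thesis"
  let ?F = "\<lambda>x. f (c (u + x)) + f (c (u + 1 + x)) + g (c (v + x)) + f (c (v + 1 + x))"
  have nn: "0 \<le> f (c t)" "0 \<le> g (c t)" if "t < m" for t
    using that c(2) f g by auto
  have "1 \<le> ?F x" if "x < L" for x
  proof -
    have "1 \<le> f (c (u + x)) + f (c (u + 1 + x)) \<or> 1 \<le> g (c (v + x)) + f (c (v + 1 + x))"
      using neg that by (meson not_less)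
    then show ?thesis
      using nn(1)[of "u + x"] nn(1)[of "u + 1 + x"] nn(2)[of "v + x"] nn(1)[of "v + 1 + x"]
        assms(5) that by auto
  qed
  then have "(\<Sum>x<L. 1) \<le> (\<Sum>x<L. ?F x)" by (intro sum_mono) auto
  also have "\<dots> \<le> (\<Sum>p<r. f p) + (\<Sum>p<r. f p) + (\<Sum>p<r. g p) + (\<Sum>p<r. f p)"
    unfolding sum.distrib using assms(5)
    by (intro add_mono sum_shifted_inj_le[OF f c] sum_shifted_inj_le[OF g c]) auto
  \<comment> \<open>The factor 3 arises because \<open>f\<close> occurs three times;
    \<open>g\<close> occurs only once, and nonnegativity covers the surplus.\<close>
  also have "\<dots> \<le> 3 * (\<Sum>p<r. f p + g p)"
    using sum_nonneg[of "{..<r}" g] g by (simp add: sum.distrib)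
  finally show False using small by simp
qed

section \<open>Translates of Lebesgue measurable sets\<close>

lemma lebesgue_translation_vimage:
  fixes A :: "real set"
  assumes "A \<in> sets lebesgue"
  shows "(\<lambda>x. x + c) -` A \<in> sets lebesgue"
proof -
  have "(\<lambda>x. x + c) -` A = (+) (- c) ` A"
    by (force simp: image_iff)
  then show ?thesis using lebesgue_sets_translation[OF assms, of "- c"] by simp
qed

lemma measure_translation_vimage:
  fixes A :: "real set"
  shows "measure lebesgue ((\<lambda>x. x + c) -` A) = measure lebesgue A"
proof -
  have "(\<lambda>x. x + c) -` A = (+) (- c) ` A"
    by (force simp: image_iff)
  then show ?thesis using measure_translation[of "- c" A] by simp
qed

section \<open>Levels and heights in successive columns\<close>

context rank_one
begin

abbreviation "h n \<equiv> height (C n)"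
abbreviation "w n \<equiv> lvl_length (C n)"
abbreviation "lft n j \<equiv> lefts (C n) ! j"
abbreviation "lev n j \<equiv> level (C n) j"

text \<open>For \<open>p < r n\<close> this is the height at which the \<open>p\<close>-th copy of
  \<open>C n\<close> starts inside \<open>C (Suc n)\<close>, so these values make up the height
  set.\<close>

definition offset :: "nat \<Rightarrow> nat \<Rightarrow> nat" where
  "offset n p = (\<Sum>k<p. h n + s n k)"

lemma r_pos [simp]: "r n > 0" "real (r n) > 0"
  using cuts[of n] by auto

lemma w_Suc: "w (Suc n) = w n / real (r n)"
  using step[of n] by (auto simp: cut_and_stack_def Let_def)

lemma w_pos [simp]: "w n > 0"
  by (induction n) (simp_all add: base unit_column_def w_Suc)

lemma w_nonneg [simp]: "w n \<ge> 0"
  by (intro less_imp_le w_pos)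

lemma w_le: "w n \<le> (1 / 2) ^ n"
proof (induction n)
  case 0
  then show ?case by (simp add: base unit_column_def)
next
  case (Suc n)
  have "w (Suc n) \<le> w n / 2"
    unfolding w_Suc using cuts[of n] by (intro divide_left_mono) auto
  then show ?case using Suc by simp
qed

text \<open>Serves two purposes: no point stays in top levels forever, and the levels around a point
  of an open set eventually lie inside that set.\<close>

lemma w_tendsto_0: "(\<lambda>n. w n) \<longlonglongrightarrow> 0"
proof (rule tendsto_sandwich[OF _ _ tendsto_const])
  show "\<forall>\<^sub>F n in sequentially. 0 \<le> w n"
    using w_pos by (simp add: less_imp_le)
  show "\<forall>\<^sub>F n in sequentially. w n \<le> (1 / 2) ^ n"
    using w_le by simp
  show "(\<lambda>n. (1 / 2 :: real) ^ n) \<longlonglongrightarrow> 0"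
    by (rule LIMSEQ_power_zero) simp
qed

lemma stacking:
  obtains sp where "\<And>k. k < r n \<Longrightarrow> length (sp k) = s n k"
    and "disjoint_levels \<lparr>lvl_length = w (Suc n), lefts = concat (map sp [0..<r n])\<rparr>"
    and "column_union \<lparr>lvl_length = w (Suc n), lefts = concat (map sp [0..<r n])\<rparr>
           \<inter> column_union (C n) = {}"
    and "lefts (C (Suc n)) = concat (map (\<lambda>k. lefts (subcolumn (C n) (r n) k) @ sp k) [0..<r n])"
proof -
  obtain sp where sp: "\<forall>k<r n. length (sp k) = s n k"
    "disjoint_levels \<lparr>lvl_length = w (Suc n), lefts = concat (map sp [0..<r n])\<rparr>"
    "column_union \<lparr>lvl_length = w (Suc n), lefts = concat (map sp [0..<r n])\<rparr>
       \<inter> column_union (C n) = {}"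
    "C (Suc n) = \<lparr>lvl_length = w (Suc n),
       lefts = concat (map (\<lambda>k. lefts (subcolumn (C n) (r n) k) @ sp k) [0..<r n])\<rparr>"
    using step[of n] unfolding cut_and_stack_def Let_def w_Suc by blast
  have "lefts (C (Suc n)) = concat (map (\<lambda>k. lefts (subcolumn (C n) (r n) k) @ sp k) [0..<r n])"
    using arg_cong[OF sp(4), of lefts] by (simp only: column.simps)
  with sp(1-3) show thesis using that by blast
qed

lemma h_Suc: "h (Suc n) = offset n (r n)"
proof -
  obtain sp where sp: "\<And>k. k < r n \<Longrightarrow> length (sp k) = s n k"
    "lefts (C (Suc n)) = concat (map (\<lambda>k. lefts (subcolumn (C n) (r n) k) @ sp k) [0..<r n])"
    by (rule stacking[of n]) blast
  then show ?thesis
    by (simp add: height_def offset_def length_concat_map_upt subcolumn_def)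
qed

lemma h_pos [simp]: "h n > 0"
proof (induction n)
  case 0
  then show ?case by (simp add: base unit_column_def height_def)
next
  case (Suc n)
  have "offset n 0 + 0 < offset n (r n)"
    unfolding offset_def using Suc by (intro block_sum_less) auto
  then show ?case by (simp add: h_Suc)
qed

lemma offset_less: "p < r n \<Longrightarrow> j < h n \<Longrightarrow> offset n p + j < h (Suc n)"
  unfolding h_Suc offset_def by (rule block_sum_less) auto

lemma offset_inject:
  "offset n p + i = offset n q + j \<Longrightarrow> i < h n \<Longrightarrow> j < h n \<Longrightarrow> p = q \<and> i = j"
  unfolding offset_def by (rule block_sum_inject[where a = "\<lambda>k. h n + s n k"]) auto

text \<open>Spacers affect only the height \<open>offset n p\<close>. On the line, copy
  \<open>p\<close> is displaced by the same amount for every \<open>j\<close>, so differences of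
  left endpoints within a copy are those of \<open>C n\<close>.\<close>

lemma lft_Suc:
  assumes "p < r n" "j < h n"
  shows "lft (Suc n) (offset n p + j) = lft n j + real p * w (Suc n)"
proof -
  obtain sp where sp: "\<And>k. k < r n \<Longrightarrow> length (sp k) = s n k"
    "lefts (C (Suc n)) = concat (map (\<lambda>k. lefts (subcolumn (C n) (r n) k) @ sp k) [0..<r n])"
    by (rule stacking[of n]) blast
  let ?f = "\<lambda>k. lefts (subcolumn (C n) (r n) k) @ sp k"
  have "offset n p = (\<Sum>k<p. length (?f k))"
    unfolding offset_def using assms(1)
    by (intro sum.cong) (auto simp: sp(1) subcolumn_def height_def)
  moreover have "j < length (lefts (C n))" using assms(2) by (simp add: height_def)
  ultimately show ?thesis
    unfolding sp(2) using assms(1) nth_concat_map_upt[of p "r n" j ?f]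
    by (simp add: subcolumn_def nth_append w_Suc)
qed

lemma lev_Suc:
  assumes "p < r n" "j < h n"
  shows "lev (Suc n) (offset n p + j)
    = {lft n j + real p * w (Suc n)..<lft n j + real p * w (Suc n) + w (Suc n)}"
  by (simp add: level_def lft_Suc assms)

lemma lev_Suc_subset:
  assumes "p < r n" "j < h n"
  shows "lev (Suc n) (offset n p + j) \<subseteq> lev n j"
proof -
  have "real p + 1 \<le> real (r n)" using assms(1) by simp
  then have "(real p + 1) * w (Suc n) \<le> real (r n) * w (Suc n)"
    by (intro mult_right_mono) auto
  also have "\<dots> = w n" by (simp add: w_Suc)
  finally have "real p * w (Suc n) + w (Suc n) \<le> w n" by (simp add: algebra_simps)
  moreover have "real p * w (Suc n) \<ge> 0" using w_pos[of "Suc n"] by (intro mult_nonneg_nonneg) auto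
  ultimately show ?thesis
    unfolding lev_Suc[OF assms] by (auto simp: level_def)
qed

lemma lev_subdivide:
  assumes "x \<in> lev n j" "j < h n"
  obtains p where "p < r n" "x \<in> lev (Suc n) (offset n p + j)"
proof -
  obtain p where "p < r n"
    "x \<in> {lft n j + real p * (w n / real (r n))..<lft n j + real p * (w n / real (r n)) + w n / real (r n)}"
    using assms by (auto simp: level_def intro: half_open_interval_subdivide[of x "lft n j" "w n" "r n"])
  then show ?thesis using that lev_Suc[of p n j] assms by (simp add: w_Suc)
qed


text \<open>Each level of \<open>C (Suc n)\<close> is a piece of a level of \<open>C n\<close> or a
  spacer. Pieces are separated by induction and by the subdivision, spacers by their assumed
  disjointness, and a piece from a spacer because spacers avoid \<open>C n\<close>.\<close>

lemma lev_disjoint: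
  "x \<in> lev n i \<Longrightarrow> x \<in> lev n j \<Longrightarrow> i < h n \<Longrightarrow> j < h n \<Longrightarrow> i = j"
proof (induction n arbitrary: i j)
  case 0
  then show ?case by (simp add: base unit_column_def height_def)
next
  case (Suc n)
  obtain sp where sp: "\<And>k. k < r n \<Longrightarrow> length (sp k) = s n k"
    and disj: "disjoint_levels \<lparr>lvl_length = w (Suc n), lefts = concat (map sp [0..<r n])\<rparr>"
      (is "disjoint_levels ?Sp")
    and apart: "column_union \<lparr>lvl_length = w (Suc n), lefts = concat (map sp [0..<r n])\<rparr>
           \<inter> column_union (C n) = {}"
    and lefts: "lefts (C (Suc n)) = concat (map (\<lambda>k. lefts (subcolumn (C n) (r n) k) @ sp k) [0..<r n])"
    by (rule stacking[of n]) blast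
  let ?f = "\<lambda>k. lefts (subcolumn (C n) (r n) k) @ sp k"
  \<comment> \<open>Position \<open>h n + t\<close> in block \<open>p\<close> is translated into an
    index of the list of all spacers, where disjointness is assumed.\<close>
  have spacer: "(\<Sum>k<p. length (sp k)) + t < height ?Sp \<and>
      lev (Suc n) (offset n p + (h n + t)) = level ?Sp ((\<Sum>k<p. length (sp k)) + t)"
    if "p < r n" "t < s n p" for p t
  proof
    show "(\<Sum>k<p. length (sp k)) + t < height ?Sp"
      using that sp block_sum_less[of p "r n" t "\<lambda>k. length (sp k)"]
      by (simp add: height_def length_concat_map_upt)
    have "offset n p = (\<Sum>k<p. length (?f k))"
      unfolding offset_def using that(1)
      by (intro sum.cong) (auto simp: sp subcolumn_def height_def)
    then have "lft (Suc n) (offset n p + (h n + t)) = ?f p ! (h n + t)"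
      unfolding lefts using that sp
      by (simp only:) (rule nth_concat_map_upt, auto simp: subcolumn_def height_def)
    also have "\<dots> = sp p ! t" by (simp add: subcolumn_def height_def nth_append)
    also have "\<dots> = lefts ?Sp ! ((\<Sum>k<p. length (sp k)) + t)"
      using that sp nth_concat_map_upt[of p "r n" t sp] by simp
    finally show "lev (Suc n) (offset n p + (h n + t)) = level ?Sp ((\<Sum>k<p. length (sp k)) + t)"
      by (simp add: level_def)
  qed
  have not_in: "x \<notin> column_union (C n)" if "p < r n" "t < s n p"
    "x \<in> lev (Suc n) (offset n p + (h n + t))" for p t
    using spacer[OF that(1,2)] that(3) apart by (auto simp: column_union_def)
  have is_in: "x \<in> column_union (C n)" if "p < r n" "u < h n"
    "x \<in> lev (Suc n) (offset n p + u)" for p u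
    using lev_Suc_subset[OF that(1,2)] that by (auto simp: column_union_def)
  obtain p u where pu: "p < r n" "u < h n + s n p" "i = offset n p + u"
    using Suc.prems(3) unfolding h_Suc offset_def by (rule block_sum_exhaust)
  obtain q v where qv: "q < r n" "v < h n + s n q" "j = offset n q + v"
    using Suc.prems(4) unfolding h_Suc offset_def by (rule block_sum_exhaust)
  consider "u < h n" "v < h n" | "u < h n" "v \<ge> h n" | "u \<ge> h n" "v < h n"
    | "u \<ge> h n" "v \<ge> h n"
    by linarith
  then show ?case
  proof cases
    case 1
    have uv: "u = v"
      using Suc.IH[of u v] Suc.prems lev_Suc_subset[OF pu(1) 1(1)] lev_Suc_subset[OF qv(1) 1(2)]
        pu(3) qv(3) 1 by auto
    moreover have "p = q"
      using Suc.prems(1,2) unfolding pu(3) qv(3) uv lev_Suc[OF pu(1) 1(2)] lev_Suc[OF qv(1) 1(2)]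
      by (rule half_open_subinterval_disjoint)
    ultimately show ?thesis using pu qv by simp
  next
    case 2
    then show ?thesis
      using is_in[OF pu(1) 2(1)] not_in[OF qv(1), of "v - h n"] Suc.prems(1,2) pu qv by auto
  next
    case 3
    then show ?thesis
      using is_in[OF qv(1) 3(2)] not_in[OF pu(1), of "u - h n"] Suc.prems(1,2) pu qv by auto
  next
    case 4
    define a b where "a = u - h n" and "b = v - h n"
    have ab: "u = h n + a" "v = h n + b" "a < s n p" "b < s n q"
      using 4 pu qv by (auto simp: a_def b_def)
    note A = spacer[OF pu(1) ab(3)] and B = spacer[OF qv(1) ab(4)]
    have "(\<Sum>k<p. length (sp k)) + a = (\<Sum>k<q. length (sp k)) + b"
      using disj Suc.prems(1,2) A B unfolding pu(3) qv(3) ab disjoint_levels_def disjoint_family_on_def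
      by (metis IntI empty_iff lessThan_iff)
    then have "p = q \<and> a = b"
      using ab sp pu qv by (intro block_sum_inject[where a = "\<lambda>k. length (sp k)"]) auto
    then show ?thesis using pu qv ab by simp
  qed
qed

section \<open>The transformation as a translation on levels\<close>

lemma column_map_eq:
  assumes "x \<in> lev n j" "Suc j < h n"
  shows "column_map (C n) x = Some (lft n (Suc j) + (x - lft n j))"
proof -
  have "(THE j. j + 1 < h n \<and> x \<in> lev n j) = j"
    using assms lev_disjoint by (intro the_equality) auto
  moreover have "\<exists>j. j + 1 < h n \<and> x \<in> lev n j" using assms by auto
  ultimately show ?thesis by (simp add: column_map_def)
qed

text \<open>The induction follows the piece containing \<open>x\<close> through later columns and
  keeps its displacement to the next level, since both left endpoints receive the same
  shift.\<close>

lemma column_map_stable: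
  assumes "x \<in> lev n j" "Suc j < h n"
  shows "column_map (C (n + t)) x = Some (lft n (Suc j) + (x - lft n j))"
proof -
  have "\<exists>i. Suc i < h (n + t) \<and> x \<in> lev (n + t) i \<and>
      lft (n + t) (Suc i) - lft (n + t) i = lft n (Suc j) - lft n j"
  proof (induction t)
    case 0
    then show ?case using assms by auto
  next
    case (Suc t)
    then obtain i where i: "Suc i < h (n + t)" "x \<in> lev (n + t) i"
      "lft (n + t) (Suc i) - lft (n + t) i = lft n (Suc j) - lft n j" by blast
    obtain p where p: "p < r (n + t)" "x \<in> lev (Suc (n + t)) (offset (n + t) p + i)"
      using i by (auto intro: lev_subdivide)
    \<comment> \<open>Levels \<open>i\<close> and \<open>Suc i\<close> belong to the same copy, so
      no spacer comes between them.\<close>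
    have "offset (n + t) p + Suc i < h (Suc (n + t))" using offset_less p(1) i(1) by blast
    moreover have "lft (Suc (n + t)) (offset (n + t) p + Suc i) - lft (Suc (n + t)) (offset (n + t) p + i)
        = lft n (Suc j) - lft n j"
      using i p(1) lft_Suc[OF p(1) i(1)] lft_Suc[OF p(1), of i] by simp
    ultimately show ?case using p(2) by (intro exI[of _ "offset (n + t) p + i"]) simp
  qed
  then obtain i where "Suc i < h (n + t)" "x \<in> lev (n + t) i"
      "lft (n + t) (Suc i) - lft (n + t) i = lft n (Suc j) - lft n j" by blast
  then show ?thesis using column_map_eq[of x "n + t" i] by simp
qed

abbreviation "T \<equiv> rank_one_map C"
abbreviation "X \<equiv> rank_one_space C"
abbreviation "M \<equiv> rank_one_measure C"

lemma T_eq: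
  assumes "x \<in> lev n j" "Suc j < h n"
  shows "T x = x + (lft n (Suc j) - lft n j)"
proof -
  have "\<forall>\<^sub>F m in sequentially. the (column_map (C m) x) = x + (lft n (Suc j) - lft n j)"
    unfolding eventually_sequentially
  proof (intro exI[of _ n] allI impI)
    fix m assume "n \<le> m"
    then show "the (column_map (C m) x) = x + (lft n (Suc j) - lft n j)"
      using column_map_stable[OF assms, of "m - n"] by simp
  qed
  then show ?thesis
    unfolding rank_one_map_def by (intro limI tendsto_eventually)
qed

lemma lev_translate: "x \<in> lev n i \<Longrightarrow> x + (lft n j - lft n i) \<in> lev n j"
  by (auto simp: level_def)

lemma T_funpow_eq:
  assumes "x \<in> lev n j" "j + t < h n"
  shows "(T ^^ t) x = x + (lft n (j + t) - lft n j)"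
  using assms(2)
proof (induction t)
  case (Suc t)
  have "(T ^^ Suc t) x = T (x + (lft n (j + t) - lft n j))" using Suc by simp
  also have "\<dots> = x + (lft n (j + t) - lft n j) + (lft n (Suc (j + t)) - lft n (j + t))"
    using Suc.prems assms(1) by (intro T_eq lev_translate) auto
  finally show ?case by simp
qed simp

lemma lev_subset_X: "j < h n \<Longrightarrow> lev n j \<subseteq> X"
  by (auto simp: rank_one_space_def column_union_def)

text \<open>
  A point that stays in the top level forever would lie in every rightmost subinterval, whose common
  right endpoint is excluded.
\<close>
lemma eventually_below_top:
  assumes "x \<in> X"
  obtains n j where "x \<in> lev n j" "Suc j < h n"
proof (rule ccontr)
  note ex = that
  assume "\<not> thesis"
  then have top: "Suc j = h n" if "x \<in> lev n j" "j < h n" for n j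
    using that ex Suc_lessI by blast
  obtain n j where nj: "j < h n" "x \<in> lev n j"
    using assms by (auto simp: rank_one_space_def column_union_def)
  define e where "e = lft n j + w n"
  have tops: "\<exists>i < h (n + t). x \<in> lev (n + t) i \<and> lft (n + t) i + w (n + t) = e" for t
  proof (induction t)
    case 0
    then show ?case using nj by (auto simp: e_def)
  next
    case (Suc t)
    define m where "m = n + t"
    obtain i where i: "i < h m" "x \<in> lev m i" "lft m i + w m = e"
      using Suc unfolding m_def by blast
    obtain p where p: "p < r m" "x \<in> lev (Suc m) (offset m p + i)"
      using i by (auto intro: lev_subdivide)
    have "Suc (offset m p + i) = offset m (r m)"
      using top[OF p(2) offset_less[OF p(1) i(1)]] by (simp add: h_Suc)
    \<comment> \<open>Otherwise the next copy would lie above a level that is already the top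
      one.\<close>
    have "\<not> Suc p < r m"
    proof
      assume "Suc p < r m"
      then have "offset m (Suc p) + 0 < h (Suc m)" by (intro offset_less) auto
      moreover have "Suc (offset m p + i) \<le> offset m (Suc p)" using i(1) by (simp add: offset_def)
      ultimately show False using \<open>Suc (offset m p + i) = offset m (r m)\<close> h_Suc by simp
    qed
    \<comment> \<open>The last piece of a level ends where the level ends, so the right endpoint
      \<open>e\<close> persists.\<close>
    then have "real p + 1 = real (r m)" using p(1) by simp
    then have "(real p + 1) * w (Suc m) = w m" using r_pos[of m] by (simp add: w_Suc)
    then have "lft (Suc m) (offset m p + i) + w (Suc m) = e"
      using i(3) lft_Suc[OF p(1) i(1)] by (simp add: distrib_right)
    then show ?case using p(2) offset_less[OF p(1) i(1)] by (auto simp: m_def)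
  qed
  have bound: "x < e" "e - x \<le> w (n + t)" for t
    using tops[of t] by (auto simp: level_def)
  have "(\<lambda>t. w (n + t)) \<longlonglongrightarrow> 0"
    using LIMSEQ_ignore_initial_segment[OF w_tendsto_0, of n] by (simp add: add.commute)
  then have "e - x \<le> 0" using bound(2) by (intro LIMSEQ_le_const) auto
  then show False using bound(1) by simp
qed


section \<open>Measurability and overlaps of positive measure\<close>

lemma lev_lmeasurable [simp]: "lev n j \<in> lmeasurable"
  unfolding level_def by (intro bounded_set_imp_lmeasurable) auto

lemma lev_sets [simp]: "lev n j \<in> sets lebesgue"
  by (simp add: fmeasurableD)

lemma measure_lev [simp]: "measure lebesgue (lev n j) = w n"
  by (simp add: level_def)

lemma column_union_lmeasurable: "column_union (C n) \<in> lmeasurable"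
  unfolding column_union_def by (intro fmeasurable.finite_UN) auto

lemma X_sets: "X \<in> sets lebesgue"
  unfolding rank_one_space_def using column_union_lmeasurable by (intro sets.countable_UN) (auto simp: fmeasurableD)

lemma space_M: "space M = X"
  by (simp add: rank_one_measure_def space_restrict_space)

lemma sets_M: "A \<in> sets M \<longleftrightarrow> A \<subseteq> X \<and> A \<in> sets lebesgue"
  unfolding rank_one_measure_def using X_sets by (subst sets_restrict_space_iff) auto

lemma emeasure_M: "A \<subseteq> X \<Longrightarrow> emeasure M A = emeasure lebesgue A"
  unfolding rank_one_measure_def using X_sets by (subst emeasure_restrict_space) auto

text \<open>The non-top levels of all columns cover \<open>X\<close>, and \<open>T\<close> is a
  translation on each of them. A preimage is thus a countable union of translated pieces.\<close>

lemma T_measurable: "T \<in> measurable M M"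
proof (rule measurableI)
  fix x assume "x \<in> space M"
  then obtain n j where nj: "x \<in> lev n j" "Suc j < h n"
    using eventually_below_top by (auto simp: space_M)
  then have "T x \<in> lev n (Suc j)" by (simp only: T_eq lev_translate)
  then show "T x \<in> space M" using lev_subset_X[OF nj(2)] by (auto simp: space_M)
next
  fix A assume A: "A \<in> sets M"
  have "T -` A \<inter> space M
      = (\<Union>n. \<Union>j\<in>{j. Suc j < h n}. lev n j \<inter> (\<lambda>x. x + (lft n (Suc j) - lft n j)) -` A)"
    (is "?L = ?R")
  proof (intro equalityI subsetI)
    fix x assume x: "x \<in> ?L"
    then obtain n j where nj: "x \<in> lev n j" "Suc j < h n"
      using eventually_below_top by (auto simp: space_M)
    then show "x \<in> ?R" using x T_eq[OF nj] by auto
  next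
    fix x assume "x \<in> ?R"
    then obtain n j where nj: "x \<in> lev n j" "Suc j < h n"
      and "x + (lft n (Suc j) - lft n j) \<in> A" by blast
    then show "x \<in> ?L" using T_eq[OF nj] lev_subset_X[of j n] by (auto simp: space_M)
  qed
  moreover have "?R \<in> sets lebesgue"
  proof (rule sets.countable_UN, clarify)
    show "(\<Union>j\<in>{j. Suc j < h n}. lev n j \<inter> (\<lambda>x. x + (lft n (Suc j) - lft n j)) -` A) \<in> sets lebesgue" for n
      using A by (intro sets.countable_UN') (auto simp: sets_M intro!: lebesgue_translation_vimage)
  qed
  ultimately show "T -` A \<inter> space M \<in> sets M"
    by (auto simp: sets_M space_M)
qed

lemma T_funpow_measurable: "T ^^ t \<in> measurable M M"
proof (induction t)
  case (Suc t)
  then show ?case using measurable_comp[OF Suc T_measurable] by (simp add: comp_def)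
qed (simp add: id_def)

lemma measure_lev_le:
  assumes "A \<in> sets lebesgue"
  shows "A \<inter> lev n j \<in> lmeasurable" "measure lebesgue (A \<inter> lev n j) \<le> w n"
proof -
  show "A \<inter> lev n j \<in> lmeasurable"
    using assms by (metis Int_commute fmeasurable_Int_fmeasurable lev_lmeasurable)
  then have "measure lebesgue (A \<inter> lev n j) \<le> measure lebesgue (lev n j)"
    by (intro measure_mono_fmeasurable) (auto simp: fmeasurableD)
  then show "measure lebesgue (A \<inter> lev n j) \<le> w n" by simp
qed

text \<open>\<open>T ^^ t\<close> translates level \<open>j\<close> onto level \<open>j + t\<close>.
  Pulling the part of \<open>A\<close> back gives two subsets of one interval of length
  \<open>w n\<close>, and total measure above \<open>w n\<close> forces them to overlap.\<close>

lemma emeasure_overlap_pos: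
  assumes A: "A \<in> sets M" and B: "B \<in> sets M" and "j + t < h n"
    and dens: "measure lebesgue (B \<inter> lev n j) + measure lebesgue (A \<inter> lev n (j + t)) > w n"
  shows "emeasure M (B \<inter> ((T ^^ t) -` A \<inter> space M)) > 0"
proof -
  define c where "c = lft n (j + t) - lft n j"
  define P Q where "P = B \<inter> lev n j" and "Q = (\<lambda>x. x + c) -` (A \<inter> lev n (j + t))"
  have Qsub: "Q \<subseteq> lev n j" by (auto simp: Q_def c_def level_def)
  have "Q \<in> sets lebesgue"
    using A unfolding Q_def by (intro lebesgue_translation_vimage) (auto simp: sets_M)
  then have Q: "Q \<in> lmeasurable" using Qsub by (meson fmeasurableI2 lev_lmeasurable)
  have P: "P \<in> lmeasurable" using B measure_lev_le(1) by (simp add: P_def sets_M)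
  have "measure lebesgue (P \<union> Q) \<le> measure lebesgue (lev n j)"
    using P Q Qsub by (intro measure_mono_fmeasurable) (auto simp: P_def fmeasurableD)
  moreover have "measure lebesgue (P \<union> Q) = measure lebesgue P + measure lebesgue Q - measure lebesgue (P \<inter> Q)"
    using P Q by (rule measure_Un3)
  moreover have "measure lebesgue Q = measure lebesgue (A \<inter> lev n (j + t))"
    unfolding Q_def by (rule measure_translation_vimage)
  ultimately have "measure lebesgue (P \<inter> Q) > 0"
    using dens by (simp add: P_def)
  then have "emeasure lebesgue (P \<inter> Q) > 0"
    using P Q by (subst emeasure_eq_measure2) (auto intro: fmeasurable.Int)
  moreover have sub: "P \<inter> Q \<subseteq> B \<inter> ((T ^^ t) -` A \<inter> space M)"
    using T_funpow_eq[OF _ assms(3)] B by (auto simp: P_def Q_def c_def space_M sets_M)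
  \<comment> \<open>Monotonicity of \<open>emeasure\<close> requires the larger set to be
    measurable.\<close>
  moreover have "B \<inter> ((T ^^ t) -` A \<inter> space M) \<in> sets M"
    using measurable_sets[OF T_funpow_measurable A] B by auto
  ultimately show ?thesis
    using emeasure_M[of "B \<inter> ((T ^^ t) -` A \<inter> space M)"]
      emeasure_mono[OF sub, of lebesgue] by (auto simp: sets_M space_M)
qed

section \<open>Levels almost filled by a given set\<close>

lemma measure_lev_Suc:
  assumes A: "A \<in> sets lebesgue" and j: "j < h n"
  shows "measure lebesgue (A \<inter> lev n j) = (\<Sum>p<r n. measure lebesgue (A \<inter> lev (Suc n) (offset n p + j)))"
proof -
  have "A \<inter> lev n j = (\<Union>p<r n. A \<inter> lev (Suc n) (offset n p + j))"
  proof (intro equalityI subsetI)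
    fix x assume x: "x \<in> A \<inter> lev n j"
    then obtain p where "p < r n" "x \<in> lev (Suc n) (offset n p + j)"
      using j by (auto intro: lev_subdivide)
    then show "x \<in> (\<Union>p<r n. A \<inter> lev (Suc n) (offset n p + j))" using x by blast
  qed (use lev_Suc_subset[OF _ j] in blast)
  moreover have "disjoint_family_on (\<lambda>p. A \<inter> lev (Suc n) (offset n p + j)) {..<r n}"
    unfolding disjoint_family_on_def
  proof (intro ballI impI)
    fix p q assume pq: "p \<in> {..<r n}" "q \<in> {..<r n}" "p \<noteq> q"
    have "offset n p + j \<noteq> offset n q + j" using offset_inject[OF _ j j] pq(3) by blast
    then show "(A \<inter> lev (Suc n) (offset n p + j)) \<inter> (A \<inter> lev (Suc n) (offset n q + j)) = {}"
      using lev_disjoint[of _ "Suc n" "offset n p + j" "offset n q + j"] offset_less[OF _ j] pq by auto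
  qed
  moreover have fin: "emeasure lebesgue (A \<inter> lev l i) \<noteq> \<infinity>" for l i
    using measure_lev_le(1)[OF A, of l i] unfolding fmeasurable_def by auto
  ultimately show ?thesis
    using A by (simp only:) (rule measure_finite_Union, auto)
qed

text \<open>
  Copies of a pair of levels inside the later columns keep their height difference, and by averaging
  one of the copies is at least as full as the original pair.
\<close>
lemma dense_pair_descend:
  assumes A: "A \<in> sets lebesgue" and B: "B \<in> sets lebesgue" and ij: "i < h n" "j < h n"
    and dens: "measure lebesgue (A \<inter> lev n i) + measure lebesgue (B \<inter> lev n j) > c * w n"
  shows "\<exists>i' < h (n + t). \<exists>j' < h (n + t). int j' - int i' = int j - int i \<and>
    measure lebesgue (A \<inter> lev (n + t) i') + measure lebesgue (B \<inter> lev (n + t) j') > c * w (n + t)"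
proof (induction t)
  case 0
  then show ?case using ij dens by auto
next
  case (Suc t)
  define m where "m = n + t"
  from Suc obtain i' j' where I: "i' < h m" "j' < h m" "int j' - int i' = int j - int i"
    "measure lebesgue (A \<inter> lev m i') + measure lebesgue (B \<inter> lev m j') > c * w m"
    unfolding m_def by blast
  let ?f = "\<lambda>p. measure lebesgue (A \<inter> lev (Suc m) (offset m p + i')) +
    measure lebesgue (B \<inter> lev (Suc m) (offset m p + j'))"
  have "\<exists>p<r m. ?f p > c * w (Suc m)"
  proof (rule ccontr)
    assume "\<not> ?thesis"
    then have "(\<Sum>p<r m. ?f p) \<le> (\<Sum>p<r m. c * w (Suc m))"
      by (intro sum_mono) (meson lessThan_iff not_less)
    also have "\<dots> = c * w m" using r_pos[of m] by (simp add: w_Suc)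
    finally show False
      using I(4) by (simp add: measure_lev_Suc[OF A I(1)] measure_lev_Suc[OF B I(2)] sum.distrib)
  qed
  then obtain p where p: "p < r m" "?f p > c * w (Suc m)" by blast
  have "n + Suc t = Suc m" by (simp add: m_def)
  then show ?case
    using p I(1-3) offset_less[OF p(1)]
    by (intro exI[of _ "offset m p + i'"] exI[of _ "offset m p + j'"] conjI) auto
qed

lemma dense_level_descend:
  assumes A: "A \<in> sets lebesgue" and "i < h n" "n \<le> N"
    and dens: "measure lebesgue (A \<inter> lev n i) > c * w n"
  obtains i' where "i' < h N" "measure lebesgue (A \<inter> lev N i') > c * w N"
  \<comment> \<open>Taking the empty set as second set makes its term vanish, which leaves a
    statement about one level.\<close>
  using dense_pair_descend[of A "{}" i n i c "N - n"] assms by auto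

lemma column_union_mono: "n \<le> m \<Longrightarrow> column_union (C n) \<subseteq> column_union (C m)"
proof (rule lift_Suc_mono_le[of "\<lambda>n. column_union (C n)"])
  fix n
  show "column_union (C n) \<subseteq> column_union (C (Suc n))"
  proof
    fix x assume "x \<in> column_union (C n)"
    then obtain j where j: "j < h n" "x \<in> lev n j" by (auto simp: column_union_def)
    then obtain p where "p < r n" "x \<in> lev (Suc n) (offset n p + j)" by (auto intro: lev_subdivide)
    then show "x \<in> column_union (C (Suc n))"
      using offset_less j by (auto simp: column_union_def)
  qed
qed

text \<open>
  Lebesgue density for levels: the levels contained in an open set \<open>U\<close> exhaust \<open>U \<inter> X\<close>, so if
  \<open>U\<close> approximates \<open>A\<close> from outside, one of these levels is almost filled by \<open>A\<close>.
\<close>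
lemma dense_level_exists:
  assumes A: "A \<in> sets M" "emeasure M A > 0" and e: "0 < e" "e < 1"
  obtains n i where "i < h n" "measure lebesgue (A \<inter> lev n i) > (1 - e) * w n"
proof (rule ccontr)
  note ex = that
  assume "\<not> thesis"
  then have sparse: "measure lebesgue (A \<inter> lev n i) \<le> (1 - e) * w n" if "i < h n" for n i
    using that ex by (meson not_less)
  have As: "A \<in> sets lebesgue" "A \<subseteq> X" using A by (auto simp: sets_M)
  \<comment> \<open>\<open>A\<close> itself may have infinite measure; its part in a single column
    is finite, as the outer approximation needs.\<close>
  obtain n0 where n0: "emeasure lebesgue (A \<inter> column_union (C n0)) > 0"
  proof (rule ccontr)
    assume "\<not> thesis"
    then have z: "emeasure lebesgue (A \<inter> column_union (C n)) = 0" for n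
      using that by (meson not_gr_zero)
    have "A = (\<Union>n. A \<inter> column_union (C n))" using As by (auto simp: rank_one_space_def)
    moreover have "emeasure lebesgue (\<Union>n. A \<inter> column_union (C n)) = 0"
      using As column_union_lmeasurable z by (intro emeasure_UN_eq_0) (auto simp: fmeasurableD)
    ultimately show False using A(2) emeasure_M[OF As(2)] by simp
  qed
  define D where "D = A \<inter> column_union (C n0)"
  have D: "D \<in> lmeasurable"
    using As column_union_lmeasurable unfolding D_def by (metis Int_commute fmeasurable_Int_fmeasurable)
  then have D0: "measure lebesgue D > 0"
    using n0 emeasure_eq_measure2[OF D] by (simp add: D_def)
  have "e * measure lebesgue D > 0" using D0 e by simp
  then obtain U where U: "open U" "D \<subseteq> U" "U \<in> lmeasurable"
      "measure lebesgue U < measure lebesgue D + e * measure lebesgue D"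
  proof -
    assume e': "e * measure lebesgue D > 0"
    obtain U where U: "open U" "D \<subseteq> U" "U - D \<in> lmeasurable"
      "emeasure lebesgue (U - D) < ennreal (e * measure lebesgue D)"
      using sets_lebesgue_outer_open[OF fmeasurableD[OF D] e'] by blast
    have U_eq: "U = D \<union> (U - D)" using U(2) by blast
    then have "U \<in> lmeasurable" using fmeasurable.Un[OF D U(3)] by simp
    moreover have "measure lebesgue U = measure lebesgue D + measure lebesgue (U - D)"
      using measure_Un2[OF D \<open>U \<in> lmeasurable\<close>] U_eq by (simp add: Un_absorb1 U(2))
    moreover have "measure lebesgue (U - D) < e * measure lebesgue D"
      using U(4) by (simp only: emeasure_eq_measure2[OF U(3)] ennreal_less_iff measure_nonneg)
    ultimately show thesis using that U by auto
  qed
  define J where "J n = {j. j < h n \<and> lev n j \<subseteq> U}" for n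
  define V where "V n = (\<Union>j\<in>J n. lev n j)" for n
  have finJ: "finite (J n)" for n by (simp add: J_def)
  have Vsub: "V n \<subseteq> U" for n by (auto simp: V_def J_def)
  have Vm: "V n \<in> lmeasurable" for n
    unfolding V_def using finJ by (intro fmeasurable.finite_UN) auto
  have disjV: "disjoint_family_on (lev n) (J n)" for n
    using lev_disjoint by (fastforce simp: disjoint_family_on_def J_def)
  \<comment> \<open>Under the contrary assumption \<open>A\<close> fills at most the fraction
    \<open>1 - e\<close> of each of the disjoint levels making up \<open>V n\<close>.\<close>
  have "measure lebesgue (D \<inter> V n) \<le> (1 - e) * measure lebesgue U" for n
  proof -
    have "measure lebesgue (D \<inter> V n) \<le> measure lebesgue (\<Union>j\<in>J n. A \<inter> lev n j)"
      using D Vm[of n] finJ[of n] measure_lev_le(1)[OF As(1)]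
      by (intro measure_mono_fmeasurable fmeasurable.finite_UN) (auto simp: D_def V_def fmeasurableD)
    also have "\<dots> \<le> (\<Sum>j\<in>J n. measure lebesgue (A \<inter> lev n j))"
      using finJ As by (intro measure_UNION_le) auto
    also have "\<dots> \<le> (\<Sum>j\<in>J n. (1 - e) * measure lebesgue (lev n j))"
      by (intro sum_mono) (auto simp: J_def sparse)
    also have "\<dots> = (1 - e) * measure lebesgue (V n)"
      unfolding V_def sum_distrib_left[symmetric] using finJ disjV
      by (subst measure_finite_Union) (auto simp: emeasure_eq_measure2)
    also have "\<dots> \<le> (1 - e) * measure lebesgue U"
      using e Vsub Vm U by (intro mult_left_mono measure_mono_fmeasurable) (auto simp: fmeasurableD)
    finally show ?thesis .
  qed
  moreover have "(\<lambda>n. measure lebesgue (D \<inter> V n)) \<longlonglongrightarrow> measure lebesgue (\<Union>n. D \<inter> V n)"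
  proof (rule Lim_measure_incseq)
    show "range (\<lambda>n. D \<inter> V n) \<subseteq> sets lebesgue" using D Vm by (auto simp: fmeasurableD)
    have "V n \<subseteq> V (Suc n)" for n
    proof
      fix x assume "x \<in> V n"
      then obtain j where j: "j < h n" "lev n j \<subseteq> U" "x \<in> lev n j" by (auto simp: V_def J_def)
      then obtain p where p: "p < r n" "x \<in> lev (Suc n) (offset n p + j)" by (auto intro: lev_subdivide)
      then show "x \<in> V (Suc n)"
        using offset_less[OF p(1) j(1)] lev_Suc_subset[OF p(1) j(1)] j(2) by (auto simp: V_def J_def)
    qed
    then show "incseq (\<lambda>n. D \<inter> V n)" by (intro incseq_SucI) blast
    have "emeasure lebesgue (\<Union>n. D \<inter> V n) \<le> emeasure lebesgue D"
      using D by (intro emeasure_mono) (auto simp: fmeasurableD)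
    then show "emeasure lebesgue (\<Union>n. D \<inter> V n) \<noteq> \<infinity>"
      using D by (auto simp: fmeasurable_def top_unique)
  qed
  \<comment> \<open>Once levels are shorter than the distance from \<open>x\<close> to the outside
    of \<open>U\<close>, the level around \<open>x\<close> lies in \<open>U\<close>.\<close>
  moreover have "(\<Union>n. D \<inter> V n) = D"
  proof -
    have "\<exists>n. x \<in> V n" if x: "x \<in> D" for x
    proof -
      obtain d where d: "d > 0" "\<And>y. dist y x < d \<Longrightarrow> y \<in> U"
        using U x by (meson open_dist subsetD)
      obtain N where N: "\<And>n. n \<ge> N \<Longrightarrow> norm (w n - 0) < d"
        using LIMSEQ_D[OF w_tendsto_0 d(1)] by blast
      define n where "n = max N n0"
      have "x \<in> column_union (C n)" using x column_union_mono[of n0 n] by (auto simp: D_def n_def)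
      then obtain j where j: "j < h n" "x \<in> lev n j" by (auto simp: column_union_def)
      have "w n < d" using N[of n] by (simp add: n_def)
      then have "lev n j \<subseteq> U" using j(2) by (auto simp: level_def dist_real_def intro!: d(2))
      then show ?thesis using j by (auto simp: V_def J_def)
    qed
    then show ?thesis by blast
  qed
  ultimately have "measure lebesgue D \<le> (1 - e) * measure lebesgue U"
    by (intro LIMSEQ_le_const2[of "\<lambda>n. measure lebesgue (D \<inter> V n)"]) auto
  \<comment> \<open>\<open>U\<close> was chosen within the factor \<open>1 + e\<close> of
    \<open>D\<close> because \<open>(1 - e) * (1 + e) < 1\<close>.\<close>
  also have "\<dots> \<le> (1 - e) * (measure lebesgue D + e * measure lebesgue D)"
    using U(4) e by (intro mult_left_mono) auto
  also have "\<dots> = measure lebesgue D - e * e * measure lebesgue D"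
    by (simp add: algebra_simps)
  also have "\<dots> < measure lebesgue D" using e D0 by simp
  finally show False by simp
qed


section \<open>Return times along the staircase\<close>

lemma height_set_offset:
  assumes "x \<in> height_set r s C n"
  obtains p where "p < r n" "x = offset n p"
proof (cases "x = 0")
  case True
  then show ?thesis using that[of 0] by (simp add: offset_def)
next
  case False
  then obtain l where "l < r n - 1" "x = (\<Sum>k=0..l. (h n + s n k))"
    using assms by (auto simp: height_set_def)
  \<comment> \<open>The sum up to \<open>l\<close> is the bottom of copy \<open>Suc l\<close>, and
    \<open>l < r n - 1\<close> ensures that this copy exists.\<close>
  then show ?thesis
    using that[of "Suc l"] by (simp add: offset_def atLeast0AtMost lessThan_Suc_atMost)
qed

text \<open>
  Consecutive steps \<open>t\<close> and \<open>t + 1\<close> of the staircase differ by \<open>h n + k + t + 1\<close>. So the time that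
  moves step \<open>u + x\<close> of level \<open>i\<close> to the next step of level \<open>i\<close> also moves step \<open>v + x\<close> of level \<open>j\<close>
  to step \<open>v + x + 1\<close> of level \<open>i\<close>, provided that \<open>j - i = v - u\<close>.
\<close>
lemma staircase_return:
  assumes A: "A \<in> sets M" and B: "B \<in> sets M" and ij: "i < h n" "j < h n" "j + u = i + v"
    and stair: "staircase_set (h n) a k m \<subseteq> height_set r s C n"
    and L: "u + v + L + 1 \<le> m"
    and dens: "3 * (2 * w n - measure lebesgue (A \<inter> lev n i) - measure lebesgue (B \<inter> lev n j)) * real (r n)
      < real L * w n"
  shows "\<exists>t>0. emeasure M (A \<inter> ((T ^^ t) -` A \<inter> space M)) > 0 \<and>
             emeasure M (B \<inter> ((T ^^ t) -` A \<inter> space M)) > 0"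
proof -
  define q where "q t = a + t * h n + (\<Sum>i=1..t. (k + i))" for t
  have q_Suc: "q (Suc t) = q t + (h n + k + Suc t)" for t by (simp add: q_def)
  then have "strict_mono q" by (simp add: strict_mono_Suc_iff)
  have "\<exists>p<r n. q t = offset n p" if "t < m" for t
  proof -
    have "q t \<in> staircase_set (h n) a k m"
      using that by (auto simp: staircase_set_def q_def)
    then show ?thesis using stair by (meson height_set_offset subsetD)
  qed
  \<comment> \<open>\<open>c t\<close> is the number of the copy that starts at the
    \<open>t\<close>-th staircase height; these heights increase strictly, so \<open>c\<close> is
    injective.\<close>
  then obtain c where c: "\<And>t. t < m \<Longrightarrow> c t < r n \<and> q t = offset n (c t)" by metis
  have "inj_on c {..<m}"
  proof (rule inj_onI)
    fix t t' assume "t \<in> {..<m}" "t' \<in> {..<m}" "c t = c t'"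
    then have "q t = q t'" using c by simp
    then show "t = t'" using strict_mono_eq[OF \<open>strict_mono q\<close>] by simp
  qed
  \<comment> \<open>The fraction of level \<open>l\<close> in copy \<open>p\<close> that
    \<open>D\<close> misses. Two deficits with sum below 1 are what
    \<open>emeasure_overlap_pos\<close> needs.\<close>
  define f where "f D l p = 1 - measure lebesgue (D \<inter> lev (Suc n) (offset n p + l)) / w (Suc n)" for D l p
  have As: "A \<in> sets lebesgue" "B \<in> sets lebesgue" using A B by (auto simp: sets_M)
  have f_nonneg: "0 \<le> f D l p" if "D \<in> sets lebesgue" for D l p
    using measure_lev_le(2)[OF that, of "Suc n" "offset n p + l"] w_pos[of "Suc n"]
    unfolding f_def by (simp add: divide_le_eq)
  \<comment> \<open>The copies have equal width, so the total deficit is \<open>r n\<close> times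
    the deficit in \<open>C n\<close>.\<close>
  have f_sum: "(\<Sum>p<r n. f D l p) = real (r n) - measure lebesgue (D \<inter> lev n l) / w n * real (r n)"
    if "D \<in> sets lebesgue" "l < h n" for D l
    unfolding f_def sum_subtractf measure_lev_Suc[OF that] sum_divide_distrib[symmetric]
    by (simp add: w_Suc)
  have "3 * (\<Sum>p<r n. f A i p + f B j p)
      = 3 * (2 * w n - measure lebesgue (A \<inter> lev n i) - measure lebesgue (B \<inter> lev n j)) * real (r n) / w n"
    unfolding sum.distrib f_sum[OF As(1) ij(1)] f_sum[OF As(2) ij(2)]
    using less_imp_neq[OF w_pos[of n]] by (simp add: diff_divide_distrib add_divide_distrib algebra_simps)
  also have "\<dots> < real L" using dens w_pos[of n] by (simp only: divide_less_eq if_True)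
  finally obtain x where x: "x < L"
    "f A i (c (u + x)) + f A i (c (u + 1 + x)) < 1" "f B j (c (v + x)) + f A i (c (v + 1 + x)) < 1"
    using small_deficits_exist[of "r n" "f A i" "f B j" c m u v L] \<open>inj_on c {..<m}\<close> c L f_nonneg As
    by (auto simp: image_subset_iff)
  define t where "t = h n + k + Suc (u + x)"
  have m: "u + x < m" "u + 1 + x < m" "v + x < m" "v + 1 + x < m" using x(1) L by auto
  have up: "offset n (c (u + 1 + x)) + i = offset n (c (u + x)) + i + t"
    using c[OF m(1)] c[OF m(2)] q_Suc[of "u + x"] by (simp add: t_def)
  \<comment> \<open>The gap after step \<open>v + x\<close> exceeds \<open>t\<close> by the integer
    \<open>v - u\<close>, which equals \<open>j - i\<close>; starting from level \<open>j\<close>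
    and landing in level \<open>i\<close> absorbs the excess.\<close>
  have across: "offset n (c (v + 1 + x)) + i = offset n (c (v + x)) + j + t"
    using c[OF m(3)] c[OF m(4)] q_Suc[of "v + x"] ij(3) by (simp add: t_def)
  have dense: "measure lebesgue (D \<inter> lev (Suc n) (offset n p + l)) +
      measure lebesgue (A \<inter> lev (Suc n) (offset n p' + i)) > w (Suc n)"
    if "f D l p + f A i p' < 1" for D l p p'
  proof -
    have "1 < (measure lebesgue (D \<inter> lev (Suc n) (offset n p + l)) +
      measure lebesgue (A \<inter> lev (Suc n) (offset n p' + i))) / w (Suc n)"
      using that by (simp add: f_def add_divide_distrib)
    then show ?thesis by (simp add: less_divide_eq)
  qed
  have "emeasure M (A \<inter> ((T ^^ t) -` A \<inter> space M)) > 0"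
    using dense[OF x(2)] offset_less[OF _ ij(1), of "c (u + 1 + x)"] c[OF m(2)]
    unfolding up by (intro emeasure_overlap_pos[OF A A]) auto
  moreover have "emeasure M (B \<inter> ((T ^^ t) -` A \<inter> space M)) > 0"
    using dense[OF x(3)] offset_less[OF _ ij(1), of "c (v + 1 + x)"] c[OF m(4)]
    unfolding across by (intro emeasure_overlap_pos[OF A B]) auto
  ultimately show ?thesis by (intro exI[of _ t]) (simp add: t_def)
qed

end

section \<open>Choice of the column and conclusion\<close>

lemma unbounded_along_filterlim:
  fixes idx f :: "nat \<Rightarrow> nat"
  assumes "filterlim idx at_top sequentially" "\<not> bdd_above (range (\<lambda>i. f (idx i)))"
  obtains i where "N \<le> idx i" "K \<le> real (f (idx i))"
proof (rule ccontr)
  note ex = that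
  assume "\<not> thesis"
  then have small: "real (f (idx i)) < K" if "N \<le> idx i" for i
    using that ex by (meson not_less)
  obtain i0 where i0: "\<And>i. i \<ge> i0 \<Longrightarrow> N \<le> idx i"
    using assms(1) unfolding filterlim_at_top eventually_sequentially by blast
  \<comment> \<open>Only the finitely many \<open>i\<close> up to \<open>i0\<close> can escape the
    bound \<open>K\<close>, so the whole range would be bounded.\<close>
  have "f (idx i) \<le> max (nat \<lceil>K\<rceil>) (Max ((\<lambda>i. f (idx i)) ` {..i0}))" for i
  proof (cases "i \<le> i0")
    case True
    then have "f (idx i) \<le> Max ((\<lambda>i. f (idx i)) ` {..i0})" by (intro Max_ge) auto
    then show ?thesis by simp
  next
    case False
    then have "real (f (idx i)) < K" using small i0 by simp
    then have "f (idx i) \<le> nat \<lceil>K\<rceil>" by linarith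
    then show ?thesis by simp
  qed
  then show False using assms(2) by (auto simp: bdd_above_def)
qed

theorem proposition4p4:
  fixes r :: "nat \<Rightarrow> nat" and s :: "nat \<Rightarrow> nat \<Rightarrow> nat" and C :: "nat \<Rightarrow> column"
  assumes "arithmetic_rank_one r s C"
  shows "weak_doubly_ergodic (rank_one_measure C) (rank_one_map C)"
proof -
  interpret rank_one r s C using assms by (simp add: arithmetic_rank_one_def)
  obtain idx a k m \<tau> where idx: "filterlim idx at_top sequentially" and \<tau>: "\<tau> > 0"
    and stair: "\<And>i. staircase_set (h (idx i)) (a (idx i)) (k (idx i)) (m (idx i))
             \<subseteq> height_set r s C (idx i)"
    and big: "\<And>i. real (m (idx i)) / real (r (idx i)) > \<tau>"
    and unb: "\<not> bdd_above (range (\<lambda>i. r (idx i)))"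
    using assms unfolding arithmetic_rank_one_def by (elim exE conjE) (rule that, auto)
  show ?thesis
    unfolding weak_doubly_ergodic_def
  proof (intro ballI impI)
    fix A B assume A: "A \<in> sets M" "emeasure M A > 0" and B: "B \<in> sets M" "emeasure M B > 0"
    have As: "A \<in> sets lebesgue" "B \<in> sets lebesgue" using A B by (auto simp: sets_M)
    \<comment> \<open>Each level may miss less than \<open>e / 2\<close>, the pair less than
      \<open>e\<close>. The 6 gives \<open>3 * e \<le> \<tau> / 2\<close>, used at the end; the
      minimum keeps \<open>e / 2\<close> below 1.\<close>
    define e where "e = min \<tau> 1 / 6"
    have e: "0 < e / 2" "e / 2 < 1" "6 * e \<le> \<tau>" using \<tau> by (auto simp: e_def)
    obtain n1 i1 where 1: "i1 < h n1" "measure lebesgue (A \<inter> lev n1 i1) > (1 - e / 2) * w n1"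
      using dense_level_exists[OF A e(1,2)] by blast
    obtain n2 i2 where 2: "i2 < h n2" "measure lebesgue (B \<inter> lev n2 i2) > (1 - e / 2) * w n2"
      using dense_level_exists[OF B e(1,2)] by blast
    define N where "N = max n1 n2"
    obtain i0 where i0: "i0 < h N" "measure lebesgue (A \<inter> lev N i0) > (1 - e / 2) * w N"
      using dense_level_descend[OF As(1) 1(1) _ 1(2)] by (metis N_def max.cobounded1)
    obtain j0 where j0: "j0 < h N" "measure lebesgue (B \<inter> lev N j0) > (1 - e / 2) * w N"
      using dense_level_descend[OF As(2) 2(1) _ 2(2)] by (metis N_def max.cobounded2)
    have sum0: "measure lebesgue (A \<inter> lev N i0) + measure lebesgue (B \<inter> lev N j0) > (2 - e) * w N"
      using i0(2) j0(2) by (simp add: algebra_simps)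
    \<comment> \<open>Truncated subtraction makes one of the two zero: their sum is the absolute
      height difference, and \<open>v - u\<close> as an integer is the signed one.\<close>
    define u v where "u = i0 - j0" and "v = j0 - i0"
    \<comment> \<open>The difference \<open>u + v\<close> is fixed before the column is chosen. This
      bound on \<open>r\<close> makes the \<open>u + v + 1\<close> steps lost at the ends at most
      half of \<open>\<tau> * r n\<close>, which leaves a window longer than the other half.\<close>
    obtain l where l: "N \<le> idx l" "2 * (real (u + v) + 1) / \<tau> \<le> real (r (idx l))"
      using unbounded_along_filterlim[OF idx unb] by blast
    define n where "n = idx l"
    obtain i j where ij: "i < h n" "j < h n" "int j - int i = int j0 - int i0"
      "measure lebesgue (A \<inter> lev n i) + measure lebesgue (B \<inter> lev n j) > (2 - e) * w n"
      using dense_pair_descend[OF As i0(1) j0(1) sum0, of "n - N"] l(1) by (auto simp: n_def)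
    have m: "real (m n) > \<tau> * real (r n)"
      using big[of l] r_pos(2)[of n] by (simp add: n_def less_divide_eq)
    have rn: "2 * (real (u + v) + 1) \<le> \<tau> * real (r n)"
      using l(2) \<tau> by (simp add: n_def divide_le_eq mult.commute)
    define L where "L = m n - (u + v + 1)"
    have "real (u + v + 1) < real (m n)" using m rn by simp
    then have "u + v + 1 \<le> m n" by linarith
    then have L: "real L > \<tau> * real (r n) / 2" "u + v + L + 1 \<le> m n"
      using m rn unfolding L_def by (simp_all add: of_nat_diff)
    have "3 * (2 * w n - measure lebesgue (A \<inter> lev n i) - measure lebesgue (B \<inter> lev n j)) * real (r n)
        < (3 * (e * w n)) * real (r n)"
      using ij(4) by (intro mult_strict_right_mono) (auto simp: algebra_simps)
    also have "\<dots> = (3 * e) * real (r n) * w n" by simp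
    also have "\<dots> \<le> (\<tau> / 2) * real (r n) * w n"
      using e by (intro mult_right_mono) auto
    also have "\<dots> \<le> real L * w n" using L(1) by (intro mult_right_mono) auto
    finally show "\<exists>t>0. emeasure M (A \<inter> ((T ^^ t) -` A \<inter> space M)) > 0 \<and>
             emeasure M (B \<inter> ((T ^^ t) -` A \<inter> space M)) > 0"
      using ij(3) stair[of l] L(2)
      by (intro staircase_return[OF A(1) B(1) ij(1,2), of u v "a n" "k n" "m n" L])
        (auto simp: n_def u_def v_def)
  qed
qed

end
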